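(* Let $p$ be a prime and let $q\in\mathbb{C}_p$ with $q\neq 1$ and $|1-q|<p^{-\frac{1}{p-1}}$. Let $\mu$ be a strongly $p$-adic $q$-invariant distribution on $\mathbb{Z}_p$, and assume that its Radon-Nikodym derivative $f_{\mu}$ on $\mathbb{Z}_p$ is a $C^{(1)}$-function. Let $\mu_{1,q}=\mu_{f_{\mu},q}$ be the strongly $p$-adic $q$-invariant distribution associated to $f_{\mu}$. Then there exists a measure $\mu_{2,q}$ on $\mathbb{Z}_p$ such that $$\mu=\mu_{1,q}+\mu_{2,q}.$$
   Context: $\mathbb{C}_p$ is the completion of an algebraic closure of $\mathbb{Q}_p$, with absolute value normalized by $|p|=p^{-1}$. For $x\in\mathbb{Z}_p$, $[x]_q=\frac{1-q^x}{1-q}$. A $C^{(1)}$-function is a function $f:\mathbb{Z}_p\to\mathbb{C}_p$ for which the difference quotient $\Delta_1 f(m,x)=\frac{f(x+m)-f(x)}{m}$ ($x,m\in\mathbb{Z}_p$, $m\ne0$) extends to a continuous function on $\mathbb{Z}_p\times\mathbb{Z}_p$; the space of these is $C^{(1)}(\mathbb{Z}_p,\mathbb{C}_p)$. A distribution on $\mathbb{Z}_p$ is a finitely additive $\mathbb{C}_p$-valued function on the compact open subsets of $\mathbb{Z}_p$. A measure on $\mathbb{Z}_p$ is a bounded distribution. A distribution $\mu$ is called a strongly $p$-adic $q$-invariant distribution if there is a positive real constant $c$ such that $$\left|[p^n]_q\,\mu(a+p^n\mathbb{Z}_p)-[p^{n+1}]_q\,\mu(a+p^{n+1}\mathbb{Z}_p)\right|\le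 c\,p^{-n}$$ for all $a\in\mathbb{Z}$ and all positive integers $n$ ($c$ independent of $a$ and $n$). For such $\mu$ the limit $$f_{\mu}(x)=\lim_{N\to\infty}[p^N]_q\,\mu(x+p^N\mathbb{Z}_p)$$ exists for every $x\in\mathbb{Z}_p$; $f_\mu$ is called the Radon-Nikodym derivative of $\mu$. For $f\in C^{(1)}(\mathbb{Z}_p,\mathbb{C}_p)$ the associated distribution $\mu_{f,q}$ is defined, for a positive integer $n$ and an integer $0\le a<p^n$, by $$\mu_{f,q}(a+p^n\mathbb{Z}_p)=\lim_{m\to\infty}\frac{1}{[p^m]_q}\sum_{x=0}^{p^{m-n}-1}f(a+p^n x)$$ (the $q$-Volkenborn integral over $a+p^n\mathbb{Z}_p$ of $y\mapsto q^{-y}f(y)$, where the $q$-Volkenborn integral on $\mathbb{Z}_p$ is $\int_{\mathbb{Z}_p}h(x)\,d\mu_q(x)=\lim_{N\to\infty}\frac{1}{[p^N]_q}\sum_{x=0}^{p^N-1}h(x)q^x$). *)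

theory Defs
  imports "HOL-Analysis.Analysis" "HOL-Computational_Algebra.Polynomial"
    "HOL-Number_Theory.Cong"
begin

text \<open>
  A non-archimedean valued field: the absolute value \<open>vabs\<close> induces the metric, so that limits,
  continuity, compactness, closure and completeness are those of the library.
\<close>

class nonarch_field = field_char_0 + metric_space +
  fixes vabs :: "'a \<Rightarrow> real"
  assumes dist_vabs: "dist x y = vabs (x - y)"
    and vabs_mult: "vabs (x * y) = vabs x * vabs y"
    and vabs_ultra: "vabs (x + y) \<le> max (vabs x) (vabs y)"

text \<open>
  The field \<open>\<complex>\<^sub>p\<close> is unique up to isometric isomorphism only, so it enters as a type with a
  property: \<open>is_Cp p TYPE('a)\<close> says that \<open>'a\<close> is a completion of an algebraic closure of
  \<open>\<rat>\<^sub>p\<close> with \<open>\<bar>p\<bar> = 1/p\<close>.  If \<open>'a\<close> is complete and \<open>\<bar>p\<bar> = 1/p\<close>, then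
  the absolute value on \<open>\<rat>\<close> is the \<open>p\<close>-adic one and the closure of \<open>\<rat>\<close> is the completion
  \<open>\<rat>\<^sub>p\<close>.
\<close>

definition Qp :: "'a::nonarch_field set"
  where "Qp = closure \<rat>"

definition Qp_alg :: "'a::nonarch_field set"
  where "Qp_alg = {x. \<exists>P. P \<noteq> 0 \<and> (\<forall>i. coeff P i \<in> Qp) \<and> poly P x = 0}"

definition is_Cp :: "nat \<Rightarrow> 'a::nonarch_field itself \<Rightarrow> bool"
  where "is_Cp p T \<longleftrightarrow>
    vabs (of_nat p :: 'a) = 1 / real p \<and>
    (\<forall>P :: 'a poly. (\<forall>i. coeff P i \<in> Qp_alg) \<and> degree P > 0 \<longrightarrow> (\<exists>x\<in>Qp_alg. poly P x = 0)) \<and>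
    closure Qp_alg = (UNIV :: 'a set) \<and>
    complete (UNIV :: 'a set)"

definition Zp :: "'a::nonarch_field set"
  where "Zp = {x \<in> Qp. vabs x \<le> 1}"

definition padic_ball :: "nat \<Rightarrow> nat \<Rightarrow> 'a::nonarch_field \<Rightarrow> 'a set"
  where "padic_ball p n a = (\<lambda>z. a + of_nat p ^ n * z) ` Zp"

definition qnum :: "'a::nonarch_field \<Rightarrow> nat \<Rightarrow> 'a"
  where "qnum q x = (1 - q ^ x) / (1 - q)"

text \<open>
  Functions on \<open>\<int>\<^sub>p\<close> and set functions on its compact open subsets are represented by
  total functions whose values elsewhere are irrelevant.
\<close>

definition C1_fun :: "('a::nonarch_field \<Rightarrow> 'a) \<Rightarrow> bool"
  where "C1_fun f \<longleftrightarrow>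
    (\<exists>F. continuous_on (Zp \<times> Zp) F \<and>
         (\<forall>m\<in>Zp. \<forall>x\<in>Zp. m \<noteq> 0 \<longrightarrow> F (m, x) = (f (x + m) - f x) / m))"

definition compact_opens :: "'a::nonarch_field set set"
  where "compact_opens = {U. U \<subseteq> Zp \<and> compact U \<and> openin (top_of_set Zp) U}"

definition is_padic_distribution :: "('a::nonarch_field set \<Rightarrow> 'a) \<Rightarrow> bool"
  where "is_padic_distribution \<mu> \<longleftrightarrow>
    (\<forall>U\<in>compact_opens. \<forall>V\<in>compact_opens. U \<inter> V = {} \<longrightarrow> \<mu> (U \<union> V) = \<mu> U + \<mu> V)"

definition is_padic_measure :: "('a::nonarch_field set \<Rightarrow> 'a) \<Rightarrow> bool"
  where "is_padic_measure \<mu> \<longleftrightarrow>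
    is_padic_distribution \<mu> \<and> (\<exists>B. \<forall>U\<in>compact_opens. vabs (\<mu> U) \<le> B)"

definition strongly_q_invariant :: "nat \<Rightarrow> 'a::nonarch_field \<Rightarrow> ('a set \<Rightarrow> 'a) \<Rightarrow> bool"
  where "strongly_q_invariant p q \<mu> \<longleftrightarrow>
    is_padic_distribution \<mu> \<and>
    (\<exists>c>0. \<forall>a::int. \<forall>n>0.
       vabs (qnum q (p ^ n) * \<mu> (padic_ball p n (of_int a))
           - qnum q (p ^ Suc n) * \<mu> (padic_ball p (Suc n) (of_int a))) \<le> c / real p ^ n)"

definition RN_derivative :: "nat \<Rightarrow> 'a::nonarch_field \<Rightarrow> ('a set \<Rightarrow> 'a) \<Rightarrow> 'a \<Rightarrow> 'a"
  where "RN_derivative p q \<mu> x = lim (\<lambda>N. qnum q (p ^ N) * \<mu> (padic_ball p N x))"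

text \<open>
  The value of \<open>\<mu>\<^bsub>f,q\<^esub>\<close> on \<open>a + p\<^sup>n \<int>\<^sub>p\<close>; truncation in \<open>m - n\<close> only affects
  finitely many terms of the sequence.
\<close>

definition assoc_ball_value ::
    "nat \<Rightarrow> 'a::nonarch_field \<Rightarrow> ('a \<Rightarrow> 'a) \<Rightarrow> nat \<Rightarrow> nat \<Rightarrow> 'a"
  where "assoc_ball_value p q f n a =
    lim (\<lambda>m. 1 / qnum q (p ^ m) * (\<Sum>x<p ^ (m - n). f (of_nat (a + p ^ n * x))))"

text \<open>
  The finitely additive extension to compact open sets: \<open>U\<close> is split into the balls of radius
  \<open>p\<^sup>-\<^sup>n\<close> contained in it, for the least \<open>n > 0\<close> such that \<open>U\<close> is a union of such balls.
  On balls it has the prescribed values; see \<open>assoc_distribution_ball\<close> below.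
\<close>

definition assoc_level :: "nat \<Rightarrow> 'a::nonarch_field set \<Rightarrow> nat"
  where "assoc_level p U = (LEAST n. n > 0 \<and> (\<forall>x\<in>U. padic_ball p n x \<subseteq> U))"

definition assoc_distribution ::
    "nat \<Rightarrow> 'a::nonarch_field \<Rightarrow> ('a \<Rightarrow> 'a) \<Rightarrow> 'a set \<Rightarrow> 'a"
  where "assoc_distribution p q f U =
    (let n = assoc_level p U
     in \<Sum>a | a < p ^ n \<and> padic_ball p n (of_nat a) \<subseteq> U. assoc_ball_value p q f n a)"

lemma vabs_0 [simp]: "vabs (0::'a::nonarch_field) = 0"
  using dist_vabs[of "0::'a" 0] by simp

lemma vabs_eq_0_iff [simp]: "vabs (x::'a::nonarch_field) = 0 \<longleftrightarrow> x = 0"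
  using dist_vabs[of x 0] by (metis diff_zero dist_eq_0_iff)

lemma vabs_nonneg [simp]: "0 \<le> vabs (x::'a::nonarch_field)"
  using dist_vabs[of x 0] by (metis diff_zero zero_le_dist)

lemma vabs_1 [simp]: "vabs (1::'a::nonarch_field) = 1"
  using vabs_mult[of "1::'a" 1] by simp

lemma vabs_minus [simp]: "vabs (- x) = vabs (x::'a::nonarch_field)"
  using dist_vabs[of 0 x] dist_vabs[of x 0] by (simp add: dist_commute)

lemma vabs_power: "vabs ((x::'a::nonarch_field) ^ n) = vabs x ^ n"
  by (induction n) (simp_all add: vabs_mult)

lemma vabs_diff_ultra: "vabs (x - y) \<le> max (vabs x) (vabs (y::'a::nonarch_field))"
  using vabs_ultra[of x "- y"] by simp

lemma vabs_of_nat_le: "vabs (of_nat n :: 'a::nonarch_field) \<le> 1"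
proof (induction n)
  case (Suc n)
  then show ?case using vabs_ultra[of "1::'a" "of_nat n"] by simp
qed simp

lemma vabs_of_int_le: "vabs (of_int n :: 'a::nonarch_field) \<le> 1"
  by (cases n) (simp_all add: vabs_of_nat_le del: of_nat_Suc)

lemma Qp_iff: "x \<in> Qp \<longleftrightarrow> (\<forall>e>0. \<exists>r\<in>\<rat>. vabs (r - x) < e)"
  unfolding Qp_def closure_approachable dist_vabs ..

lemma Qp_of_Rats: "r \<in> \<rat> \<Longrightarrow> r \<in> Qp"
  unfolding Qp_def using closure_subset by blast

lemma Qp_add:
  assumes "x \<in> Qp" "y \<in> Qp" shows "x + y \<in> Qp"
  unfolding Qp_iff
proof (intro allI impI)
  fix e :: real assume "e > 0"
  then obtain r s where "r \<in> \<rat>" "vabs (r - x) < e" "s \<in> \<rat>" "vabs (s - y) < e"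
    using assms unfolding Qp_iff by blast
  moreover have "vabs ((r + s) - (x + y)) \<le> max (vabs (r - x)) (vabs (s - y))"
    using vabs_ultra[of "r - x" "s - y"] by (simp add: algebra_simps)
  ultimately show "\<exists>t\<in>\<rat>. vabs (t - (x + y)) < e"
    by (intro bexI[of _ "r + s"]) auto
qed

lemma Qp_scale:
  assumes "x \<in> Qp" "c \<in> \<rat>" shows "c * x \<in> Qp"
proof (cases "c = 0")
  case True
  then show ?thesis by (simp add: Qp_of_Rats)
next
  case False
  show ?thesis unfolding Qp_iff
  proof (intro allI impI)
    fix e :: real assume "e > 0"
    moreover have c: "vabs c > 0" using False vabs_nonneg[of c] by (simp add: order_less_le)
    ultimately have "e / vabs c > 0" by simp
    then obtain r where r: "r \<in> \<rat>" "vabs (r - x) < e / vabs c"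
      using assms unfolding Qp_iff by blast
    have "vabs (c * r - c * x) = vabs c * vabs (r - x)"
      by (simp add: vabs_mult flip: right_diff_distrib)
    also have "\<dots> < e" using r c by (simp add: field_simps)
    finally show "\<exists>t\<in>\<rat>. vabs (t - c * x) < e"
      using r assms by (intro bexI[of _ "c * r"]) auto
  qed
qed

lemma Zp_add: "x \<in> Zp \<Longrightarrow> y \<in> Zp \<Longrightarrow> x + y \<in> Zp"
  unfolding Zp_def using vabs_ultra[of x y] by (auto intro: Qp_add)

lemma Zp_scale:
  assumes "c \<in> \<int>" "x \<in> Zp" shows "c * x \<in> Zp"
proof -
  obtain k where "c = of_int k" using assms(1) by (auto elim: Ints_cases)
  then have "vabs c \<le> 1" "c \<in> \<rat>" by (auto simp: vabs_of_int_le)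
  then show ?thesis
    using assms(2) by (auto simp: Zp_def vabs_mult Qp_scale intro: mult_le_one)
qed

lemma Zp_of_Ints: "c \<in> \<int> \<Longrightarrow> c \<in> Zp"
  by (auto simp: Zp_def vabs_of_int_le Qp_of_Rats elim!: Ints_cases)

lemma Zp_of_nat_pow: "of_nat p ^ n \<in> Zp"
  by (intro Zp_of_Ints) simp

lemma padic_ball_self: "a \<in> padic_ball p n a"
  unfolding padic_ball_def using Zp_of_Ints[of 0] by (auto intro!: image_eqI[where x = 0])

lemma padic_ball_mono:
  assumes "x \<in> padic_ball p n a" shows "padic_ball p n x \<subseteq> padic_ball p n a"
proof -
  obtain z where z: "z \<in> Zp" "x = a + of_nat p ^ n * z"
    using assms by (auto simp: padic_ball_def)
  have "x + of_nat p ^ n * w = a + of_nat p ^ n * (z + w)" for w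
    using z by (simp add: algebra_simps)
  then show ?thesis using z by (auto simp: padic_ball_def intro!: imageI Zp_add)
qed

lemma vabs_of_nat_pow:
  assumes "is_Cp p TYPE('a::nonarch_field)"
  shows "vabs (of_nat p ^ n :: 'a) = 1 / real p ^ n"
  using assms by (simp add: is_Cp_def vabs_power power_divide)

lemma padic_ball_vabs:
  assumes "is_Cp p TYPE('a::nonarch_field)" "x \<in> padic_ball p n (a::'a)"
  shows "vabs (x - a) \<le> 1 / real p ^ n"
proof -
  obtain z where z: "z \<in> Zp" "x = a + of_nat p ^ n * z"
    using assms by (auto simp: padic_ball_def)
  then have "vabs (x - a) = 1 / real p ^ n * vabs z"
    by (simp add: vabs_mult vabs_of_nat_pow[OF assms(1)])
  also have "\<dots> \<le> 1 / real p ^ n * 1"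
    using z by (intro mult_left_mono) (auto simp: Zp_def)
  finally show ?thesis by simp
qed

lemma vabs_of_int_coprime:
  assumes Cp: "is_Cp p TYPE('a::nonarch_field)" and p: "prime p" and "\<not> int p dvd k"
  shows "vabs (of_int k :: 'a) = 1"
proof -
  have "coprime (int p) k" using p assms(3) by (simp add: prime_imp_coprime)
  then obtain u v where "u * int p + v * k = 1"
    using bezout_int[of "int p" k] by auto
  then have "of_int u * of_nat p + of_int v * of_int k = (1::'a)"
    by (metis of_int_1 of_int_add of_int_mult of_int_of_nat_eq)
  then have "1 \<le> max (vabs (of_int u * of_nat p :: 'a)) (vabs (of_int v * of_int k :: 'a))"
    using vabs_ultra[of "of_int u * of_nat p :: 'a" "of_int v * of_int k"] by simp
  moreover have "vabs (of_int u * of_nat p :: 'a) < 1"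
  proof -
    have "vabs (of_int u * of_nat p :: 'a) \<le> 1 * vabs (of_nat p :: 'a)"
      unfolding vabs_mult by (intro mult_right_mono vabs_of_int_le) simp
    also have "\<dots> < 1" using Cp prime_gt_1_nat[OF p] by (simp add: is_Cp_def)
    finally show ?thesis .
  qed
  ultimately have "1 \<le> vabs (of_int v * of_int k :: 'a)" by linarith
  also have "\<dots> \<le> 1 * vabs (of_int k :: 'a)"
    unfolding vabs_mult by (intro mult_right_mono vabs_of_int_le) simp
  finally show ?thesis using vabs_of_int_le[of k, where 'a='a] by simp
qed

lemma pow_dvd_if_vabs_le:
  assumes Cp: "is_Cp p TYPE('a::nonarch_field)" and p: "prime p"
  shows "vabs (of_int k :: 'a) \<le> 1 / real p ^ n \<Longrightarrow> int p ^ n dvd k"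
proof (induction n arbitrary: k)
  case (Suc n)
  have p1: "real p > 1" using prime_gt_1_nat[OF p] by simp
  then have "1 / real p ^ Suc n < 1" by (simp add: one_less_power del: power_Suc)
  then have "int p dvd k" using vabs_of_int_coprime[OF Cp p, of k] Suc.prems by fastforce
  then obtain j where j: "k = int p * j" ..
  have "vabs (of_int k :: 'a) = 1 / real p * vabs (of_int j :: 'a)"
    using Cp by (simp add: j vabs_mult is_Cp_def)
  then have "vabs (of_int j :: 'a) \<le> 1 / real p ^ n"
  proof -
    have "vabs (of_int j :: 'a) = real p * vabs (of_int k :: 'a)"
      using p1 \<open>vabs (of_int k :: 'a) = _\<close> by simp
    also have "\<dots> \<le> real p * (1 / real p ^ Suc n)"
      using Suc.prems p1 by (intro mult_left_mono) auto
    finally show ?thesis using p1 by simp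
  qed
  then show ?case using Suc.IH[of j] by (simp add: j)
qed simp

lemma assoc_level_ball:
  assumes Cp: "is_Cp p TYPE('a::nonarch_field)" and p: "prime p" and n: "n > 0"
  shows "assoc_level p (padic_ball p n (a::'a)) = n"
  unfolding assoc_level_def
proof (rule Least_equality)
  show "n > 0 \<and> (\<forall>x\<in>padic_ball p n a. padic_ball p n x \<subseteq> padic_ball p n a)"
    using n padic_ball_mono by blast
next
  fix k assume k: "k > 0 \<and> (\<forall>x\<in>padic_ball p n a. padic_ball p k x \<subseteq> padic_ball p n a)"
  have "a + of_nat p ^ k \<in> padic_ball p k a"
    unfolding padic_ball_def using Zp_of_Ints[of 1] by (auto intro!: image_eqI[where x = 1])
  then have "a + of_nat p ^ k \<in> padic_ball p n a" using k padic_ball_self by blast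
  from padic_ball_vabs[OF Cp this] have "1 / real p ^ k \<le> 1 / real p ^ n"
    by (simp add: vabs_of_nat_pow[OF Cp])
  then have "real p ^ n \<le> real p ^ k"
    using prime_gt_0_nat[OF p] by (simp add: field_simps)
  then show "n \<le> k" using prime_gt_1_nat[OF p] by simp
qed

lemma assoc_distribution_ball:
  assumes Cp: "is_Cp p TYPE('a::nonarch_field)" and p: "prime p" and n: "n > 0" and a: "a < p ^ n"
  shows "assoc_distribution p (q::'a) f (padic_ball p n (of_nat a)) = assoc_ball_value p q f n a"
proof -
  have "b = a" if b: "b < p ^ n" "padic_ball p n (of_nat b :: 'a) \<subseteq> padic_ball p n (of_nat a)" for b
  proof -
    have "of_nat b \<in> padic_ball p n (of_nat a :: 'a)" using b padic_ball_self by blast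
    from padic_ball_vabs[OF Cp this] have "vabs (of_int (int b - int a) :: 'a) \<le> 1 / real p ^ n"
      by simp
    from pow_dvd_if_vabs_le[OF Cp p this] have "[int b = int a] (mod int (p ^ n))"
      by (simp add: cong_iff_dvd_diff)
    then have "[b = a] (mod p ^ n)" by (simp only: cong_int_iff)
    then show "b = a" using a b by (auto intro: cong_less_modulus_unique_nat)
  qed
  then have "{b. b < p ^ n \<and> padic_ball p n (of_nat b :: 'a) \<subseteq> padic_ball p n (of_nat a)} = {a}"
    using a by blast
  then show ?thesis
    by (simp add: assoc_distribution_def assoc_level_ball[OF Cp p n])
qed

end

theory Submission
  imports Defs
begin

text \<open>
  Write \<open>f\<close> for the Radon-Nikodym derivative of \<open>\<mu>\<close> and \<open>\<mu>\<^sub>1\<close> for the distribution associated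
  to \<open>f\<close>.  The measure \<open>\<mu>\<^sub>2\<close> can only be the difference \<open>\<mu> - \<mu>\<^sub>1\<close>, so two things
  are to be shown: \<open>\<mu>\<^sub>1\<close> is additive, and \<open>\<mu> - \<mu>\<^sub>1\<close> is bounded.  Both follow from one
  formula, valid for every compact open \<open>U\<close> (\<open>assoc_distribution_tendsto\<close>):
  \<open>\<mu>\<^sub>1 U\<close> is the limit of the Riemann sums
  \<open>1 / [p\<^sup>m]\<^sub>q \<cdot> (\<Sum>y | y < p\<^sup>m \<and> y \<in> U. f y)\<close>.
  These sums are additive in \<open>U\<close>, hence so is \<open>\<mu>\<^sub>1\<close>.

  For boundedness, the strong invariance of \<open>\<mu>\<close> telescopes to
  \<open>\<bar>f y - [p\<^sup>m]\<^sub>q \<mu>(y + p\<^sup>m \<int>\<^sub>p)\<bar> \<le> c p\<^sup>-\<^sup>m\<close> (\<open>RN_derivative_approx\<close>), and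
  \<open>\<bar>[p\<^sup>m]\<^sub>q\<bar> = p\<^sup>-\<^sup>m\<close> in the given range of \<open>q\<close> (\<open>vabs_qnum\<close>).  Once \<open>m\<close> is so large that
  \<open>U\<close> is a union of residue classes modulo \<open>p\<^sup>m\<close>, finite additivity writes \<open>\<mu> U\<close> as the sum of the
  \<open>\<mu>(y + p\<^sup>m \<int>\<^sub>p)\<close> (\<open>distribution_decompose\<close>).  So \<open>\<mu> U\<close> minus the Riemann sum is a sum of
  terms of absolute value at most \<open>c\<close>, and by the ultrametric inequality it is bounded by \<open>c\<close>
  however many terms there are.  The bound survives the limit, with the same constant \<open>c\<close>.

  The analytic point is that the Riemann sums converge at all, and this is where the
  \<open>C\<^sup>(\<^sup>1\<^sup>)\<close> hypothesis enters.  Since the ratio \<open>p\<^sup>m / [p\<^sup>m]\<^sub>q\<close> converges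
  (\<open>convergent_p_power_over_qnum\<close>), the parameter \<open>q\<close> can be removed, and what is left is the
  existence of the ordinary Volkenborn integral of a \<open>C\<^sup>(\<^sup>1\<^sup>)\<close>-function
  (\<open>volkenborn_convergent\<close>).
\<close>

section \<open>Limits in a non-archimedean valued field\<close>

lemma vabs_minus_commute: "vabs (x - y) = vabs (y - x :: 'a::nonarch_field)"
  using vabs_minus[of "x - y"] by simp

lemma vabs_divide: "vabs (x / y) = vabs x / vabs (y :: 'a::nonarch_field)"
proof (cases "y = 0")
  case False
  then have "vabs x = vabs (x / y) * vabs y" by (simp flip: vabs_mult)
  then show ?thesis using False by simp
qed simp

lemma vabs_sum_le:
  fixes f :: "'b \<Rightarrow> 'a::nonarch_field"
  assumes "\<And>x. x \<in> A \<Longrightarrow> vabs (f x) \<le> B" and "B \<ge> 0"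
  shows "vabs (sum f A) \<le> B"
  using assms(1)
proof (induction A rule: infinite_finite_induct)
  case (insert x A)
  then show ?case using vabs_ultra[of "f x" "sum f A"] by fastforce
qed (use assms(2) in auto)

lemma vabs_sum_less:
  fixes f :: "'b \<Rightarrow> 'a::nonarch_field"
  assumes "\<And>x. x \<in> A \<Longrightarrow> vabs (f x) < B" and "B > 0"
  shows "vabs (sum f A) < B"
  using assms(1)
proof (induction A rule: infinite_finite_induct)
  case (insert x A)
  then show ?case using vabs_ultra[of "f x" "sum f A"] by fastforce
qed (use assms(2) in auto)

lemma tendsto_vabs_iff:
  fixes f :: "'b \<Rightarrow> 'a::nonarch_field"
  shows "(f \<longlongrightarrow> a) F \<longleftrightarrow> ((\<lambda>x. vabs (f x - a)) \<longlongrightarrow> 0) F"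
  by (subst tendsto_dist_iff) (simp add: dist_vabs)

lemma tendsto_vabs_bound:
  fixes f :: "'b \<Rightarrow> 'a::nonarch_field"
  assumes "\<And>x. vabs (f x - a) \<le> g x" and "(g \<longlongrightarrow> 0) F"
  shows "(f \<longlongrightarrow> a) F"
  unfolding tendsto_vabs_iff
proof (rule Lim_null_comparison[OF always_eventually assms(2)], rule allI)
  show "norm (vabs (f x - a)) \<le> g x" for x using assms(1)[of x] by simp
qed

text \<open>
  Sums and products are continuous for the metric given by \<open>vabs\<close>.  As instances, these two facts
  make the general calculus of limits and continuity applicable to valued fields.
\<close>
instance nonarch_field < topological_ab_group_add
proof
  fix a b :: 'a
  let ?F = "nhds a \<times>\<^sub>F nhds b"
  have "((\<lambda>x. max (vabs (fst x - a)) (vabs (snd x - b))) \<longlongrightarrow> max 0 0) ?F"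
    using filterlim_fst[of "nhds a" "nhds b"] filterlim_snd[of "nhds b" "nhds a"]
    by (intro tendsto_max) (simp_all add: tendsto_vabs_iff)
  moreover have "vabs (fst x + snd x - (a + b)) \<le> max (vabs (fst x - a)) (vabs (snd x - b))" for x
    using vabs_ultra[of "fst x - a" "snd x - b"] by (simp add: algebra_simps)
  ultimately show "((\<lambda>x. fst x + snd x) \<longlongrightarrow> a + b) ?F"
    by (intro tendsto_vabs_bound) simp_all
  show "(uminus \<longlongrightarrow> - a) (nhds a)"
  proof -
    have "vabs (- x + a) = vabs (x - a)" for x using vabs_minus_commute[of a x] by simp
    then show ?thesis using tendsto_ident_at[of a UNIV] filterlim_ident[of "nhds a"]
      unfolding tendsto_vabs_iff by simp
  qed
qed

instance nonarch_field < topological_semigroup_mult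
proof
  fix a b :: 'a
  let ?F = "nhds a \<times>\<^sub>F nhds b"
  have "vabs (x * y - a * b) \<le> max (max (vabs (x - a) * vabs (y - b)) (vabs a * vabs (y - b)))
      (vabs (x - a) * vabs b)" for x y
  proof -
    have "x * y - a * b = ((x - a) * (y - b) + a * (y - b)) + (x - a) * b"
      by (simp add: algebra_simps)
    then show ?thesis
      using vabs_ultra[of "(x - a) * (y - b)" "a * (y - b)"]
        vabs_ultra[of "(x - a) * (y - b) + a * (y - b)" "(x - a) * b"]
      by (simp only: vabs_mult)
  qed
  moreover have "((\<lambda>z. max (max (vabs (fst z - a) * vabs (snd z - b)) (vabs a * vabs (snd z - b)))
      (vabs (fst z - a) * vabs b)) \<longlongrightarrow> max (max (0 * 0) (vabs a * 0)) (0 * vabs b)) ?F"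
    using filterlim_fst[of "nhds a" "nhds b"] filterlim_snd[of "nhds b" "nhds a"]
    by (intro tendsto_max tendsto_mult tendsto_const) (simp_all add: tendsto_vabs_iff)
  ultimately show "((\<lambda>x. fst x * snd x) \<longlongrightarrow> a * b) ?F"
    by (intro tendsto_vabs_bound) simp_all
qed

lemma vabs_tendsto_le:
  fixes X :: "nat \<Rightarrow> 'a::nonarch_field"
  assumes "X \<longlonglongrightarrow> L" and "\<forall>\<^sub>F n in sequentially. vabs (X n) \<le> B"
  shows "vabs L \<le> B"
proof -
  have "vabs x = dist x 0" for x :: 'a by (simp add: dist_vabs)
  then show ?thesis
    using tendsto_upperbound[OF tendsto_dist[OF assms(1) tendsto_const[of 0]], of B] assms(2) by simp
qed

text \<open>
  By the ultrametric inequality \<open>X m - X n\<close> is no larger than the largest of the successive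
  differences between them, so null differences already make a sequence Cauchy.
\<close>
lemma convergent_if_diff_null:
  fixes X :: "nat \<Rightarrow> 'a::nonarch_field"
  assumes "complete (UNIV :: 'a set)" and null: "(\<lambda>n. X (Suc n) - X n) \<longlonglongrightarrow> 0"
  shows "convergent X"
proof -
  have "Cauchy X"
  proof (rule metric_CauchyI)
    fix e :: real assume "e > 0"
    then obtain N where N: "\<And>n. n \<ge> N \<Longrightarrow> vabs (X (Suc n) - X n) < e"
      using null[unfolded lim_sequentially dist_vabs] by auto
    have *: "vabs (X n - X N) < e" if "n \<ge> N" for n
      using that
    proof (induction n rule: dec_induct)
      case (step n)
      then show ?case using N[of n] vabs_ultra[of "X (Suc n) - X n" "X n - X N"] by simp
    qed (use \<open>e > 0\<close> in simp)
    show "\<exists>M. \<forall>m\<ge>M. \<forall>n\<ge>M. dist (X m) (X n) < e"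
    proof (intro exI allI impI)
      fix m n assume "m \<ge> N" "n \<ge> N"
      then show "dist (X m) (X n) < e"
        using *[of m] *[of n] vabs_diff_ultra[of "X m - X N" "X n - X N"] by (simp add: dist_vabs)
    qed
  qed
  then show ?thesis
    using assms(1) by (auto simp: complete_def convergent_def)
qed

section \<open>Compact open sets, finite additivity and residue classes\<close>

lemma compact_opens_Un: 
  "U \<in> compact_opens \<Longrightarrow> V \<in> compact_opens \<Longrightarrow>
    U \<union> V \<in> (compact_opens :: 'a::nonarch_field set set)"
  by (auto simp: compact_opens_def compact_Un openin_Un)

lemma compact_opens_empty: "{} \<in> (compact_opens :: 'a::nonarch_field set set)"
  by (simp add: compact_opens_def)

lemma compact_opens_UN:
  assumes "finite I" "\<And>i. i \<in> I \<Longrightarrow> B i \<in> (compact_opens :: 'a::nonarch_field set set)"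
  shows "(\<Union>i\<in>I. B i) \<in> compact_opens"
  using assms by (induction I) (auto intro: compact_opens_Un compact_opens_empty)

lemma distribution_finite_UN:
  fixes B :: "'b \<Rightarrow> 'a::nonarch_field set"
  assumes \<mu>: "is_padic_distribution \<mu>" and "finite I"
    and "\<And>i. i \<in> I \<Longrightarrow> B i \<in> compact_opens" and "disjoint_family_on B I"
  shows "\<mu> (\<Union>i\<in>I. B i) = (\<Sum>i\<in>I. \<mu> (B i))"
  using assms(2-)
proof (induction I)
  case empty
  have "\<mu> ({} \<union> {}) = \<mu> {} + \<mu> {}"
    using \<mu> compact_opens_empty unfolding is_padic_distribution_def by blast
  then show ?case by simp
next
  case (insert i I)
  have "B i \<inter> (\<Union>j\<in>I. B j) = {}"
    using insert.prems(2) insert.hyps(2) by (fastforce simp: disjoint_family_on_def)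
  moreover have "(\<Union>j\<in>I. B j) \<in> compact_opens"
    using insert.prems(1) insert.hyps(1) by (intro compact_opens_UN) auto
  ultimately have "\<mu> (B i \<union> (\<Union>j\<in>I. B j)) = \<mu> (B i) + \<mu> (\<Union>j\<in>I. B j)"
    using \<mu> insert.prems(1) unfolding is_padic_distribution_def by auto
  moreover have "disjoint_family_on B I"
    using insert.prems(2) by (simp add: disjoint_family_on_def)
  ultimately show ?case using insert by simp
qed

lemma Zp_of_nat: "of_nat n \<in> Zp"
  by (simp add: Zp_of_Ints)

text \<open>
  A union of balls of radius \<open>p\<^sup>-\<^sup>n\<close> contains a natural number precisely when it contains the
  whole ball around the residue of that number modulo \<open>p\<^sup>n\<close>.  So sums over the members of \<open>U\<close> below
  \<open>p\<^sup>m\<close> can be grouped by balls.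
\<close>
lemma mem_iff_ball_subset:
  fixes U :: "'a::nonarch_field set"
  assumes level: "\<forall>x\<in>U. padic_ball p n x \<subseteq> U"
  shows "of_nat (a + p ^ n * x) \<in> U \<longleftrightarrow> padic_ball p n (of_nat a :: 'a) \<subseteq> U"
proof
  let ?y = "of_nat (a + p ^ n * x) :: 'a"
  have "of_nat a = ?y + of_nat p ^ n * (- of_nat x)" by simp
  then have "of_nat a \<in> padic_ball p n ?y"
    unfolding padic_ball_def by (intro image_eqI[where x = "- of_nat x"] Zp_of_Ints) auto
  then show "padic_ball p n (of_nat a :: 'a) \<subseteq> U" if "?y \<in> U" using level that by blast
  have "?y \<in> padic_ball p n (of_nat a)"
    unfolding padic_ball_def by (intro image_eqI[where x = "of_nat x"] Zp_of_nat) simp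
  then show "?y \<in> U" if "padic_ball p n (of_nat a :: 'a) \<subseteq> U" using that by blast
qed

text \<open>
  Rescales a function on the ball \<open>a + b \<int>\<^sub>p\<close> to one on \<open>\<int>\<^sub>p\<close>, which reduces integrals over
  balls to integrals over the whole of \<open>\<int>\<^sub>p\<close>.
\<close>
lemma C1_fun_affine:
  fixes f :: "'a::nonarch_field \<Rightarrow> 'a"
  assumes "C1_fun f" and a: "a \<in> Zp" and b: "b \<noteq> 0"
    and mult: "\<And>x. x \<in> Zp \<Longrightarrow> b * x \<in> Zp"
  shows "C1_fun (\<lambda>x. f (a + b * x))"
proof -
  obtain F where F: "continuous_on (Zp \<times> Zp) F"
    and quot: "\<And>m x. m \<in> Zp \<Longrightarrow> x \<in> Zp \<Longrightarrow> m \<noteq> 0 \<Longrightarrow> F (m, x) = (f (x + m) - f x) / m"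
    using assms(1) unfolding C1_fun_def by metis
  let ?G = "\<lambda>(m, x). b * F (b * m, a + b * x)"
  have "continuous_on (Zp \<times> Zp) (\<lambda>z. F (b * fst z, a + b * snd z))"
  proof (rule continuous_on_compose2[OF F])
    show "continuous_on (Zp \<times> Zp) (\<lambda>z. (b * fst z, a + b * snd z))"
      by (intro continuous_intros)
    show "(\<lambda>z. (b * fst z, a + b * snd z)) ` (Zp \<times> Zp) \<subseteq> Zp \<times> Zp"
      using a mult Zp_add by fastforce
  qed
  then have "continuous_on (Zp \<times> Zp) ?G"
    unfolding case_prod_unfold by (intro continuous_on_mult' continuous_on_const)
  moreover have "?G (m, x) = (f (a + b * (x + m)) - f (a + b * x)) / m"
    if "m \<in> Zp" "x \<in> Zp" "m \<noteq> 0" for m x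
  proof -
    have "F (b * m, a + b * x) = (f (a + b * x + b * m) - f (a + b * x)) / (b * m)"
      using that a b mult by (intro quot Zp_add) auto
    then show ?thesis using that b by (simp add: distrib_left add_ac)
  qed
  ultimately show ?thesis unfolding C1_fun_def by blast
qed

text \<open>
  Every number below \<open>M N\<close> is \<open>x + M j\<close> with a residue \<open>x\<close> modulo \<open>M\<close>.  With powers of \<open>p\<close> for
  \<open>M\<close> and \<open>N\<close>, the inner sum runs over points of one \<open>p\<close>-adic ball.
\<close>
lemma sum_residue_blocks:
  fixes h :: "nat \<Rightarrow> 'b::comm_monoid_add"
  shows "(\<Sum>y<M * N. h y) = (\<Sum>x<M. \<Sum>j<N. h (x + M * j))"
proof -
  have "(\<Sum>y<M * N. h y) = (\<Sum>j<N. \<Sum>y=j * M..<j * M + M. h y)"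
    by (simp add: sum.nat_group mult.commute)
  also have "\<dots> = (\<Sum>j<N. \<Sum>x<M. h (x + M * j))"
  proof (rule sum.cong[OF refl])
    fix j
    show "(\<Sum>y=j * M..<j * M + M. h y) = (\<Sum>x<M. h (x + M * j))"
      using sum.shift_bounds_nat_ivl[of h 0 "j * M" M]
      by (simp add: lessThan_atLeast0 add.commute mult.commute)
  qed
  finally show ?thesis by (simp add: sum.swap[of _ "{..<M}"])
qed

section \<open>The p-adic integers and their balls\<close>

lemma Qp_closed: "closed (Qp :: 'a::nonarch_field set)"
  by (simp add: Qp_def)

context
  fixes p :: nat
  assumes p: "prime p" and Cp: "is_Cp p TYPE('a::nonarch_field)"
begin

lemma p_gt_1: "real p > 1"
  using prime_gt_1_nat[OF p] by simp

lemma vabs_p: "vabs (of_nat p :: 'a) = 1 / real p"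
  using Cp by (simp add: is_Cp_def)

lemma one_over_p_power_small:
  assumes "e > 0" shows "\<exists>n. 1 / real p ^ n < e"
  using real_arch_pow_inv[OF assms, of "1 / real p"] p_gt_1 by (auto simp: power_divide)

lemma one_over_p_power_mono: "m \<le> n \<Longrightarrow> 1 / real p ^ n \<le> 1 / real p ^ m"
  using p_gt_1 by (intro divide_left_mono power_increasing) auto

lemma vabs_p_power_mult_le:
  assumes "x \<in> (Zp :: 'a set)" shows "vabs (of_nat p ^ n * x) \<le> 1 / real p ^ n"
proof -
  have "vabs (of_nat p ^ n * x) = 1 / real p ^ n * vabs x"
    by (simp add: vabs_mult vabs_of_nat_pow[OF Cp])
  also have "\<dots> \<le> 1 / real p ^ n * 1"
    using assms by (intro mult_left_mono) (auto simp: Zp_def)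
  finally show ?thesis by simp
qed

lemma padic_ball_iff:
  assumes a: "a \<in> (Zp :: 'a set)"
  shows "x \<in> padic_ball p n a \<longleftrightarrow> x \<in> Zp \<and> vabs (x - a) \<le> 1 / real p ^ n"
proof
  assume x: "x \<in> padic_ball p n a"
  then obtain z where "z \<in> Zp" "x = a + of_nat p ^ n * z" by (auto simp: padic_ball_def)
  then have "x \<in> Zp" using a by (auto intro!: Zp_add Zp_scale)
  then show "x \<in> Zp \<and> vabs (x - a) \<le> 1 / real p ^ n" using padic_ball_vabs[OF Cp x] by simp
next
  assume x: "x \<in> Zp \<and> vabs (x - a) \<le> 1 / real p ^ n"
  have p0: "(of_nat p :: 'a) \<noteq> 0" using p_gt_1 by auto
  define z where "z = inverse (of_nat p ^ n) * (x + (- 1) * a)"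
  have "z \<in> Qp" using x a unfolding z_def
    by (intro Qp_scale Qp_add) (auto simp: Zp_def)
  moreover have "vabs z \<le> 1"
  proof -
    have "z = (x - a) / of_nat p ^ n" by (simp add: z_def divide_inverse mult.commute)
    then have "vabs z = vabs (x - a) * real p ^ n" by (simp add: vabs_divide vabs_of_nat_pow[OF Cp])
    then show ?thesis using x p_gt_1 by (simp add: pos_le_divide_eq)
  qed
  moreover have "x = a + of_nat p ^ n * z"
    using p0 by (simp add: z_def flip: mult.assoc)
  ultimately show "x \<in> padic_ball p n a" by (auto simp: padic_ball_def Zp_def)
qed

text \<open>
  A rational number \<open>u / v\<close> close to \<open>x\<close> has absolute value at most \<open>1\<close>, so that \<open>p\<close> does not
  divide \<open>v\<close> and the congruence \<open>v a = u\<close> modulo \<open>p\<^sup>n\<close> is solvable.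
\<close>
lemma Zp_approx_nat:
  assumes x: "x \<in> (Zp :: 'a set)"
  shows "\<exists>a<p ^ n. vabs (x - of_nat a) \<le> 1 / real p ^ n"
proof -
  have "1 / real p ^ n > 0" using p_gt_1 by simp
  then obtain r where r: "r \<in> \<rat>" "vabs (r - x) < 1 / real p ^ n"
    using x unfolding Zp_def Qp_iff by blast
  have "1 / real p ^ n \<le> 1" using p_gt_1 by (simp add: one_le_power)
  then have r1: "vabs r \<le> 1" using r vabs_ultra[of "r - x" x] x by (auto simp: Zp_def)
  obtain u v where uv: "v > 0" "coprime u v" "r = of_int u / of_int v"
    using r(1) by (elim Rats_cases') auto
  have v: "\<not> int p dvd v"
  proof
    assume "int p dvd v"
    then obtain w where w: "v = int p * w" ..
    have "\<not> int p dvd u"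
      using uv(2) \<open>int p dvd v\<close> p coprime_common_divisor_int[of u v "int p"] by auto
    from vabs_of_int_coprime[OF Cp p this]
    have "1 = vabs r * vabs (of_int v :: 'a)" using uv by (simp add: vabs_divide)
    also have "\<dots> \<le> 1 * vabs (of_int v :: 'a)" using r1 by (intro mult_right_mono) auto
    also have "\<dots> \<le> 1 / real p * 1"
      unfolding w using vabs_of_int_le[of w, where 'a='a] p_gt_1
      by (simp add: vabs_mult vabs_p divide_right_mono)
    finally show False using p_gt_1 by simp
  qed
  then have "coprime v (int (p ^ n))" using p
    by (metis coprime_commute coprime_power_left_iff of_nat_power prime_imp_coprime prime_nat_int_transfer)
  then obtain y where y: "[v * y = 1] (mod int (p ^ n))" using cong_solve_coprime_int by blast
  define a where "a = nat ((u * y) mod int (p ^ n))"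
  have P: "int (p ^ n) > 0" using prime_gt_0_nat[OF p] by simp
  have a: "int a = (u * y) mod int (p ^ n)" using P by (simp add: a_def)
  have "[v * int a = v * (u * y)] (mod int (p ^ n))"
    unfolding a by (intro cong_mult cong_refl) simp
  also have "[v * (u * y) = u * (v * y)] (mod int (p ^ n))" by (simp add: mult_ac)
  also have "[u * (v * y) = u * 1] (mod int (p ^ n))" by (intro cong_mult cong_refl y)
  finally have "int (p ^ n) dvd v * int a - u" by (simp add: cong_iff_dvd_diff)
  then obtain w where w: "v * int a - u = int (p ^ n) * w" ..
  have "r - of_nat a = - (of_int (v * int a - u) / of_int v)"
    using uv by (simp add: field_simps)
  (* p does not divide v, hence v is a unit *)
  also have "vabs \<dots> = vabs (of_int (v * int a - u) :: 'a)"
    using vabs_of_int_coprime[OF Cp p v] by (simp add: vabs_divide)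
  also have "\<dots> = 1 / real p ^ n * vabs (of_int w :: 'a)"
    unfolding w by (simp add: vabs_mult vabs_power vabs_p power_divide)
  also have "\<dots> \<le> 1 / real p ^ n * 1" by (intro mult_left_mono vabs_of_int_le) simp
  finally have "vabs (r - of_nat a) \<le> 1 / real p ^ n" by simp
  then have "vabs (x - of_nat a) \<le> 1 / real p ^ n"
    using vabs_diff_ultra[of "r - of_nat a" "r - x"] r by simp
  moreover have "a < p ^ n"
    using a P by (metis of_nat_less_iff pos_mod_bound)
  ultimately show ?thesis by blast
qed

lemma nat_congruent_eq:
  assumes "a < p ^ n" "b < p ^ n" "vabs (of_nat a - of_nat b :: 'a) \<le> 1 / real p ^ n"
  shows "a = b"
proof -
  have "vabs (of_int (int a - int b) :: 'a) \<le> 1 / real p ^ n" using assms(3) by simp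
  from pow_dvd_if_vabs_le[OF Cp p this] have "[int a = int b] (mod int (p ^ n))"
    by (simp add: cong_iff_dvd_diff)
  then have "[a = b] (mod p ^ n)" by (simp only: cong_int_iff)
  then show ?thesis using assms by (auto intro: cong_less_modulus_unique_nat)
qed

text \<open>
  Approximation by the finitely many natural numbers below \<open>p\<^sup>n\<close> makes \<open>\<int>\<^sub>p\<close> totally bounded.
\<close>
lemma compact_Zp: "compact (Zp :: 'a set)"
  unfolding compact_eq_totally_bounded
proof (intro conjI allI impI)
  have "Zp = Qp \<inter> cball (0::'a) 1"
    by (auto simp: Zp_def dist_vabs)
  then have "closed (Zp :: 'a set)" using closed_Int[OF Qp_closed closed_cball] by metis
  then show "complete (Zp :: 'a set)"
    using Cp complete_closed_subset[of "Zp :: 'a set" UNIV] by (simp add: is_Cp_def)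
  fix e :: real assume "e > 0"
  then obtain n where n: "1 / real p ^ n < e" using one_over_p_power_small by blast
  have "Zp \<subseteq> (\<Union>x\<in>of_nat ` {..<p ^ n}. ball (x :: 'a) e)"
  proof
    fix x :: 'a assume "x \<in> Zp"
    then obtain a where "a < p ^ n" "vabs (x - of_nat a) \<le> 1 / real p ^ n"
      using Zp_approx_nat by blast
    then show "x \<in> (\<Union>x\<in>of_nat ` {..<p ^ n}. ball (x :: 'a) e)"
      using n by (auto simp: dist_vabs vabs_minus_commute intro!: bexI[of _ a])
  qed
  then show "\<exists>k. finite k \<and> (Zp :: 'a set) \<subseteq> (\<Union>x\<in>k. ball x e)" by blast
qed

lemma padic_ball_compact_open:
  assumes a: "a \<in> (Zp :: 'a set)"
  shows "padic_ball p n a \<in> compact_opens"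
proof -
  have "padic_ball p n a = Zp \<inter> cball a (1 / real p ^ n)"
    using padic_ball_iff[OF a] by (auto simp: dist_vabs vabs_minus_commute)
  then have "compact (padic_ball p n a)" using compact_Zp by (simp add: compact_Int_closed)
  moreover have "openin (top_of_set Zp) (padic_ball p n a)"
    unfolding openin_euclidean_subtopology_iff
  proof (intro conjI ballI)
    show "padic_ball p n a \<subseteq> Zp" using padic_ball_iff[OF a] by blast
    fix x assume x: "x \<in> padic_ball p n a"
    show "\<exists>e>0. \<forall>y\<in>Zp. dist y x < e \<longrightarrow> y \<in> padic_ball p n a"
    proof (intro exI[of _ "1 / real p ^ n"] conjI ballI impI)
      show "1 / real p ^ n > 0" using p_gt_1 by simp
      fix y :: 'a assume "y \<in> Zp" "dist y x < 1 / real p ^ n"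
      then show "y \<in> padic_ball p n a"
        using x vabs_ultra[of "y - x" "x - a"] by (auto simp: padic_ball_iff[OF a] dist_vabs)
    qed
  qed
  ultimately show ?thesis using padic_ball_iff[OF a] by (auto simp: compact_opens_def)
qed

text \<open>
  A compact set inside an open one has positive distance from the complement of the open one.
\<close>
lemma compact_open_level:
  assumes "U \<in> (compact_opens :: 'a set set)"
  shows "\<exists>n>0. \<forall>x\<in>U. padic_ball p n x \<subseteq> U"
proof -
  obtain T where T: "open T" "U = Zp \<inter> T" and "compact U" "U \<subseteq> Zp"
    using assms by (auto simp: compact_opens_def openin_open)
  then obtain e where e: "e > 0" "(\<Union>x\<in>U. ball x e) \<subseteq> T"
    using compact_subset_open_imp_ball_epsilon_subset[of U T] by auto
  obtain m where m: "1 / real p ^ m < e" using one_over_p_power_small[OF e(1)] by blast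
  have "1 / real p ^ Suc m \<le> 1 / real p ^ m"
    using p_gt_1 by (intro divide_left_mono power_increasing) auto
  then have m': "1 / real p ^ Suc m < e" using m by linarith
  have "padic_ball p (Suc m) x \<subseteq> U" if x: "x \<in> U" for x
  proof
    fix y assume "y \<in> padic_ball p (Suc m) x"
    then have "y \<in> Zp" "vabs (y - x) \<le> 1 / real p ^ Suc m"
      using padic_ball_iff[of x] x \<open>U \<subseteq> Zp\<close> by blast+
    then show "y \<in> U" using T e(2) x m' by (fastforce simp: dist_vabs vabs_minus_commute)
  qed
  then show ?thesis by blast
qed

section \<open>Distributions and Radon-Nikodym derivatives\<close>

text \<open>
  A set that is a union of balls of radius \<open>p\<^sup>-\<^sup>n\<close> is also one of balls of any smaller radius
  \<open>p\<^sup>-\<^sup>m\<close>, and the natural numbers below \<open>p\<^sup>m\<close> represent each of these balls once.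
\<close>
lemma distribution_decompose:
  assumes \<mu>: "is_padic_distribution \<mu>" and U: "U \<in> (compact_opens :: 'a set set)"
    and level: "\<forall>x\<in>U. padic_ball p n x \<subseteq> U" and mn: "m \<ge> n"
  shows "\<mu> U = (\<Sum>y | y < p ^ m \<and> of_nat y \<in> U. \<mu> (padic_ball p m (of_nat y)))"
proof -
  let ?I = "{y. y < p ^ m \<and> (of_nat y :: 'a) \<in> U}" and ?B = "\<lambda>y. padic_ball p m (of_nat y :: 'a)"
  have UZ: "U \<subseteq> Zp" using U by (simp add: compact_opens_def)
  have level_m: "padic_ball p m x \<subseteq> U" if "x \<in> U" for x
    using level that UZ one_over_p_power_mono[OF mn]
    by (fastforce simp: padic_ball_iff subset_iff)
  have "U = (\<Union>y\<in>?I. ?B y)"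
  proof
    show "U \<subseteq> (\<Union>y\<in>?I. ?B y)"
    proof
      fix x assume x: "x \<in> U"
      then obtain a where a: "a < p ^ m" "vabs (x - of_nat a) \<le> 1 / real p ^ m"
        using Zp_approx_nat UZ by blast
      have "of_nat a \<in> padic_ball p m x"
        using a x UZ by (auto simp: padic_ball_iff vabs_minus_commute Zp_of_nat)
      then have "of_nat a \<in> U" using level_m x by blast
      moreover have "x \<in> ?B a"
        using a x UZ by (auto simp: padic_ball_iff Zp_of_nat)
      ultimately show "x \<in> (\<Union>y\<in>?I. ?B y)" using a by blast
    qed
    show "(\<Union>y\<in>?I. ?B y) \<subseteq> U" using level_m by blast
  qed
  moreover have "disjoint_family_on ?B ?I"
    unfolding disjoint_family_on_def
  proof (intro ballI impI)
    fix a b assume ab: "a \<in> ?I" "b \<in> ?I" "a \<noteq> b"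
    show "?B a \<inter> ?B b = {}"
    proof (rule ccontr)
      assume "?B a \<inter> ?B b \<noteq> {}"
      then obtain x :: 'a
        where "vabs (x - of_nat a) \<le> 1 / real p ^ m" "vabs (x - of_nat b) \<le> 1 / real p ^ m"
        by (auto simp: padic_ball_iff Zp_of_nat)
      then have "vabs (of_nat a - of_nat b :: 'a) \<le> 1 / real p ^ m"
        using vabs_diff_ultra[of "x - of_nat b" "x - of_nat a"] by simp
      then show False using nat_congruent_eq ab by blast
    qed
  qed
  moreover have "finite ?I" by simp
  ultimately show ?thesis
    using distribution_finite_UN[OF \<mu>, of ?I ?B] padic_ball_compact_open[OF Zp_of_nat] by simp
qed

text \<open>
  The differences of consecutive terms \<open>[p\<^sup>N]\<^sub>q \<mu>(x + p\<^sup>N \<int>\<^sub>p)\<close> for \<open>N \<ge> n\<close> are all bounded by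
  \<open>c p\<^sup>-\<^sup>n\<close>, hence so is any sum of them, and so is the distance from the limit to the \<open>n\<close>-th term.
\<close>
lemma RN_derivative_approx:
  fixes \<mu> :: "'a set \<Rightarrow> 'a"
  assumes c: "\<And>n. n > 0 \<Longrightarrow>
      vabs (qnum q (p ^ n) * \<mu> (padic_ball p n x)
        - qnum q (p ^ Suc n) * \<mu> (padic_ball p (Suc n) x)) \<le> c / real p ^ n"
    and c0: "c > 0" and n: "n > 0"
  shows "vabs (RN_derivative p q \<mu> x - qnum q (p ^ n) * \<mu> (padic_ball p n x)) \<le> c / real p ^ n"
proof -
  define X where "X = (\<lambda>N. qnum q (p ^ N) * \<mu> (padic_ball p N x))"
  have increment: "vabs (X (Suc N) - X N) \<le> c / real p ^ N" if "N > 0" for N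
    using c[OF that] by (simp add: X_def vabs_minus_commute)
  have tele: "vabs (X N - X n) \<le> c / real p ^ n" if "N \<ge> n" for N
    using that
  proof (induction N rule: dec_induct)
    case (step N)
    have "vabs (X (Suc N) - X N) \<le> c / real p ^ N" using \<open>n \<le> N\<close> n by (intro increment) simp
    also have "\<dots> \<le> c / real p ^ n"
      using mult_left_mono[OF one_over_p_power_mono[OF \<open>n \<le> N\<close>], of c] c0 by simp
    finally show ?case using step.IH vabs_ultra[of "X (Suc N) - X N" "X N - X n"] by simp
  qed (use c0 p_gt_1 in simp)
  (* the estimate says nothing about N = 0, so convergence is shown for the shifted sequence *)
  have "convergent (\<lambda>N. X (Suc N))"
  proof (rule convergent_if_diff_null)
    show "complete (UNIV :: 'a set)" using Cp by (simp add: is_Cp_def)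
    have "(\<lambda>N. c / real p ^ Suc N) \<longlonglongrightarrow> 0"
      using p_gt_1 by (intro LIMSEQ_Suc tendsto_divide_0[OF tendsto_const]
          filterlim_at_top_imp_at_infinity filterlim_realpow_sequentially_gt1) auto
    then show "(\<lambda>N. X (Suc (Suc N)) - X (Suc N)) \<longlonglongrightarrow> 0"
      by (rule tendsto_vabs_bound[rotated]) (simp only: diff_zero, rule increment, simp)
  qed
  then have "X \<longlonglongrightarrow> RN_derivative p q \<mu> x"
    unfolding RN_derivative_def X_def[symmetric] convergent_Suc_iff by (rule convergent_LIMSEQ_iff[THEN iffD1])
  then have "(\<lambda>N. X N - X n) \<longlonglongrightarrow> RN_derivative p q \<mu> x - X n"
    by (intro tendsto_diff tendsto_const)
  then have "vabs (RN_derivative p q \<mu> x - X n) \<le> c / real p ^ n"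
    by (rule vabs_tendsto_le) (use tele in \<open>auto intro: eventually_sequentiallyI\<close>)
  then show ?thesis by (simp add: X_def)
qed

section \<open>The Volkenborn integral of a C1-function\<close>

text \<open>
  For \<open>k = K + i\<close> with \<open>K\<close> large, uniform continuity allows replacing \<open>h\<close> by its value at the
  residue modulo \<open>p\<^sup>K\<close>.  This turns the sum into \<open>p\<^sup>i\<close> times a sum that does not depend on \<open>i\<close>, and
  \<open>p\<^sup>i\<close> tends to \<open>0\<close>.
\<close>
lemma sum_below_p_power_tendsto_0:
  fixes h :: "'a \<Rightarrow> 'a"
  assumes "continuous_on Zp h"
  shows "(\<lambda>k. \<Sum>x<p ^ k. h (of_nat x)) \<longlonglongrightarrow> 0"
proof (rule metric_LIMSEQ_I)
  fix e :: real assume e: "e > 0"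
  let ?S = "\<lambda>k. \<Sum>x<p ^ k. h (of_nat x)"
  have "uniformly_continuous_on Zp h"
    using assms compact_Zp by (rule compact_uniformly_continuous)
  then obtain d where d: "d > 0"
    "\<And>x y. x \<in> Zp \<Longrightarrow> y \<in> Zp \<Longrightarrow> dist y x < d \<Longrightarrow> dist (h y) (h x) < e"
    using e unfolding uniformly_continuous_on_def by metis
  obtain K where K: "1 / real p ^ K < d" using one_over_p_power_small[OF d(1)] by blast
  define B where "B = vabs (?S K)"
  have "B \<ge> 0" by (simp add: B_def)
  then obtain i\<^sub>0 where i\<^sub>0: "1 / real p ^ i\<^sub>0 < e / (B + 1)"
    using one_over_p_power_small[of "e / (B + 1)"] e by auto
  show "\<exists>N. \<forall>k\<ge>N. dist (?S k) 0 < e"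
  proof (intro exI allI impI)
    fix k assume k: "k \<ge> K + i\<^sub>0"
    define i where "i = k - K"
    have i: "k = K + i" "i \<ge> i\<^sub>0" using k by (auto simp: i_def)
    have "?S k = (\<Sum>x<p ^ K. \<Sum>j<p ^ i. h (of_nat (x + p ^ K * j)))"
      unfolding i(1) power_add by (rule sum_residue_blocks)
    then have "?S k - of_nat p ^ i * ?S K =
        (\<Sum>x<p ^ K. \<Sum>j<p ^ i. h (of_nat (x + p ^ K * j)) - h (of_nat x))"
      by (simp add: sum_subtractf sum_distrib_left)
    also have "vabs \<dots> < e"
    proof (intro vabs_sum_less e)
      fix x j
      have "vabs (of_nat (x + p ^ K * j) - of_nat x :: 'a) < d"
        using vabs_p_power_mult_le[OF Zp_of_nat[of j], of K] K by simp
      then show "vabs (h (of_nat (x + p ^ K * j)) - h (of_nat x)) < e"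
        using d(2)[OF Zp_of_nat Zp_of_nat] by (simp only: dist_vabs)
    qed
    finally have 1: "vabs (?S k - of_nat p ^ i * ?S K) < e" .
    have "vabs (of_nat p ^ i * ?S K) = 1 / real p ^ i * B"
      by (simp only: vabs_mult vabs_of_nat_pow[OF Cp] B_def)
    also have "\<dots> \<le> 1 / real p ^ i\<^sub>0 * (B + 1)"
      using i(2) \<open>B \<ge> 0\<close> by (intro mult_mono one_over_p_power_mono) auto
    also have "\<dots> < e" using i\<^sub>0 \<open>B \<ge> 0\<close> by (simp add: field_simps)
    finally show "dist (?S k) 0 < e"
      using 1 vabs_ultra[of "?S k - of_nat p ^ i * ?S K" "of_nat p ^ i * ?S K"]
      by (simp add: dist_vabs)
  qed
qed

text \<open>
  Passing from \<open>p\<^sup>k\<close> to \<open>p\<^sup>k\<^sup>+\<^sup>1\<close> changes the mean value by the sum over \<open>j < p\<close> of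
  \<open>(j / p) \<cdot> (\<Sum>x<p\<^sup>k. G (p\<^sup>k j, x))\<close>, where \<open>G\<close> is the extended difference quotient of \<open>g\<close>.
  As \<open>p\<^sup>k j\<close> tends to \<open>0\<close>, the first argument of \<open>G\<close> may be replaced by \<open>0\<close>, and sums of the continuous
  function \<open>\<lambda>x. G (0, x)\<close> over \<open>x < p\<^sup>k\<close> tend to \<open>0\<close>.  So the change tends to \<open>0\<close>.
\<close>
lemma volkenborn_convergent:
  fixes g :: "'a \<Rightarrow> 'a"
  assumes "C1_fun g"
  shows "convergent (\<lambda>k. (\<Sum>x<p ^ k. g (of_nat x)) / of_nat p ^ k)"
proof (rule convergent_if_diff_null)
  show "complete (UNIV :: 'a set)" using Cp by (simp add: is_Cp_def)
  obtain G where G: "continuous_on (Zp \<times> Zp) G"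
    and quot: "\<And>m x. m \<in> Zp \<Longrightarrow> x \<in> Zp \<Longrightarrow> m \<noteq> 0 \<Longrightarrow> G (m, x) = (g (x + m) - g x) / m"
    using assms unfolding C1_fun_def by metis
  let ?V = "\<lambda>k. (\<Sum>x<p ^ k. g (of_nat x)) / of_nat p ^ k"
  define T where "T = (\<lambda>j k. \<Sum>x<p ^ k. G (of_nat p ^ k * of_nat j, of_nat x))"
  have p0: "(of_nat p :: 'a) \<noteq> 0" using p_gt_1 by auto
  have diff: "?V (Suc k) - ?V k = (\<Sum>j<p. of_nat j / of_nat p * T j k)" for k
  proof -
    have *: "g (of_nat (x + p ^ k * j)) - g (of_nat x) =
        of_nat p ^ k * (of_nat j * G (of_nat p ^ k * of_nat j, of_nat x))" for x j
    proof (cases "j = 0")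
      case False
      have "G (of_nat (p ^ k * j), of_nat x) =
          (g (of_nat x + of_nat (p ^ k * j)) - g (of_nat x)) / of_nat (p ^ k * j)"
        using False p0 by (intro quot Zp_of_nat) auto
      then show ?thesis using False p0 by simp
    qed simp
    have "?V (Suc k) - ?V k
        = ((\<Sum>x<p ^ k * p. g (of_nat x)) - of_nat p * (\<Sum>x<p ^ k. g (of_nat x)))
            / of_nat p ^ Suc k"
      using p0 by (simp add: diff_divide_distrib mult.commute)
    also have "(\<Sum>x<p ^ k * p. g (of_nat x)) - of_nat p * (\<Sum>x<p ^ k. g (of_nat x))
        = (\<Sum>x<p ^ k. \<Sum>j<p. g (of_nat (x + p ^ k * j)) - g (of_nat x))"
      by (subst sum_residue_blocks) (simp add: sum_subtractf sum_distrib_left)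
    also have "\<dots> = (\<Sum>j<p. \<Sum>x<p ^ k. g (of_nat (x + p ^ k * j)) - g (of_nat x))"
      by (rule sum.swap)
    also have "\<dots> = of_nat p ^ k * (\<Sum>j<p. of_nat j * T j k)"
      unfolding * T_def by (simp only: sum_distrib_left)
    finally show ?thesis
      using p0 by (simp add: sum_divide_distrib)
  qed
  have T0: "T j \<longlonglongrightarrow> 0" for j
  proof -
    have h: "continuous_on Zp (\<lambda>x. G (0, x))"
      by (rule continuous_on_compose2[OF G]) (auto intro!: continuous_intros Zp_of_Ints)
    have "(\<lambda>k. \<Sum>x<p ^ k. G (of_nat p ^ k * of_nat j, of_nat x) - G (0, of_nat x)) \<longlonglongrightarrow> 0"
    proof (rule metric_LIMSEQ_I)
      fix e :: real assume e: "e > 0"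
      have "uniformly_continuous_on (Zp \<times> Zp) G"
        using G compact_Times[OF compact_Zp compact_Zp]
        by (rule compact_uniformly_continuous)
      then obtain d where d: "d > 0"
        "\<And>u v. u \<in> Zp \<times> Zp \<Longrightarrow> v \<in> Zp \<times> Zp \<Longrightarrow> dist v u < d \<Longrightarrow> dist (G v) (G u) < e"
        using e unfolding uniformly_continuous_on_def by metis
      obtain K where K: "1 / real p ^ K < d" using one_over_p_power_small[OF d(1)] by blast
      show "\<exists>N. \<forall>k\<ge>N. dist (\<Sum>x<p ^ k. G (of_nat p ^ k * of_nat j, of_nat x) - G (0, of_nat x)) 0 < e"
      proof (intro exI allI impI)
        fix k assume k: "k \<ge> K"
        have "vabs (G (of_nat p ^ k * of_nat j, of_nat x) - G (0, of_nat x)) < e" for x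
        proof -
          have "vabs (of_nat p ^ k * of_nat j :: 'a) < d"
            using vabs_p_power_mult_le[OF Zp_of_nat, of k j] one_over_p_power_mono[OF k] K by linarith
          then have "dist (of_nat p ^ k * of_nat j :: 'a, of_nat x :: 'a) (0, of_nat x) < d"
            by (simp add: dist_Pair_Pair dist_vabs)
          then show ?thesis
            unfolding dist_vabs[symmetric] by (intro d(2)) (auto intro: Zp_of_Ints)
        qed
        then show "dist (\<Sum>x<p ^ k. G (of_nat p ^ k * of_nat j, of_nat x) - G (0, of_nat x)) 0 < e"
          unfolding dist_vabs diff_zero by (intro vabs_sum_less e)
      qed
    qed
    from tendsto_add[OF this sum_below_p_power_tendsto_0[OF h]]
    show ?thesis by (simp add: T_def sum_subtractf)
  qed
  have "(\<lambda>k. of_nat j / of_nat p * T j k) \<longlonglongrightarrow> 0" for j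
    using tendsto_mult[OF tendsto_const T0, of "of_nat j / of_nat p" j] by simp
  then show "(\<lambda>k. ?V (Suc k) - ?V k) \<longlonglongrightarrow> 0"
    unfolding diff by (intro tendsto_null_sum)
qed

section \<open>Absolute values of q-numbers\<close>

text \<open>
  With \<open>t = Q - 1\<close>, the binomial expansion is \<open>Q\<^sup>p - 1 = p t + \<dots> + t\<^sup>p\<close>.  The middle terms are
  smaller than \<open>p t\<close> because \<open>p\<close> divides their binomial coefficients and \<open>\<bar>t\<bar> < 1\<close>; the last
  one is smaller exactly when \<open>\<bar>t\<bar>\<^sup>p\<^sup>-\<^sup>1 < 1/p\<close>.  The radius \<open>p\<^sup>-\<^sup>1\<^sup>/\<^sup>(\<^sup>p\<^sup>-\<^sup>1\<^sup>)\<close> for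
  \<open>q\<close> thus makes \<open>p t\<close> the dominant term.
\<close>
lemma vabs_one_minus_power_p:
  fixes Q :: 'a
  assumes t: "vabs (1 - Q) ^ (p - 1) < 1 / real p"
  shows "vabs (1 - Q ^ p) = vabs (1 - Q) / real p"
proof (cases "Q = 1")
  case False
  define t where "t = Q - 1"
  have t0: "vabs t > 0" using False by (simp add: t_def order_less_le)
  have tQ: "vabs (1 - Q) = vabs t" by (simp add: t_def vabs_minus_commute)
  have "1 / real p < 1" using p_gt_1 by simp
  then have t1: "vabs t < 1"
    using assms one_le_power[of "vabs t" "p - 1"] unfolding tQ by linarith
  have p2: "p \<ge> 2" using p prime_ge_2_nat by blast
  define R where "R = (\<Sum>k=2..p. of_nat (p choose k) * t ^ k)"
  have split: "{..p} = insert 0 (insert 1 {2..p})" using p2 by auto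
  have "Q ^ p = (\<Sum>k\<le>p. of_nat (p choose k) * t ^ k)"
    using binomial_ring[of t 1 p] by (simp add: t_def)
  also have "\<dots> = 1 + (of_nat p * t + R)"
    unfolding split R_def by simp
  finally have eq: "Q ^ p - 1 = of_nat p * t + R" by simp
  have pt: "vabs (of_nat p * t) = vabs t / real p" by (simp add: vabs_mult vabs_p)
  have "vabs R < vabs t / real p"
    unfolding R_def
  proof (rule vabs_sum_less)
    show "vabs t / real p > 0" using t0 p_gt_1 by simp
    fix k assume k: "k \<in> {2..p}"
    show "vabs (of_nat (p choose k) * t ^ k) < vabs t / real p"
    proof (cases "k = p")
      case True
      have "vabs (t ^ p) = vabs t ^ (p - 1) * vabs t"
        using p2 by (simp add: vabs_power flip: power_Suc2)
      also have "\<dots> < 1 / real p * vabs t"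
        using assms t0 unfolding tQ by (intro mult_strict_right_mono)
      finally show ?thesis using True by simp
    next
      case False
      then have "p dvd (p choose k)" using k p by (intro dvd_choose_prime) auto
      then obtain j where "p choose k = p * j" ..
      then have "vabs (of_nat (p choose k) :: 'a) = 1 / real p * vabs (of_nat j :: 'a)"
        by (simp add: vabs_mult vabs_p)
      also have "\<dots> \<le> 1 / real p * 1" by (intro mult_left_mono vabs_of_nat_le) simp
      finally have "vabs (of_nat (p choose k) * t ^ k) \<le> 1 / real p * vabs t ^ k"
        unfolding vabs_mult vabs_power by (intro mult_right_mono) auto
      also have "vabs t ^ k < vabs t ^ 1"
        using k t0 t1 by (intro power_strict_decreasing) auto
      finally show ?thesis using p_gt_1 by (simp add: field_simps)
    qed
  qed
  (* the term of strictly largest absolute value determines that of the sum *)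
  then have "vabs (of_nat p * t + R) = vabs (of_nat p * t)"
    using vabs_ultra[of "of_nat p * t" R] vabs_diff_ultra[of "of_nat p * t + R" R] pt by auto
  then show ?thesis using pt eq tQ vabs_minus_commute[of 1 "Q ^ p"] by simp
qed simp

context
  fixes q :: 'a
  assumes q1: "q \<noteq> 1" and q: "vabs (1 - q) ^ (p - 1) < 1 / real p"
begin

lemma vabs_one_minus_p_power: "vabs (1 - q ^ (p ^ n)) = vabs (1 - q) / real p ^ n"
proof (induction n)
  case (Suc n)
  have "vabs (1 - q) / real p ^ n \<le> vabs (1 - q)"
    using divide_left_mono[of 1 "real p ^ n" "vabs (1 - q)"] p_gt_1 by (simp add: one_le_power)
  then have "(vabs (1 - q) / real p ^ n) ^ (p - 1) \<le> vabs (1 - q) ^ (p - 1)"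
    by (intro power_mono) auto
  then have "vabs (1 - q ^ (p ^ n)) ^ (p - 1) < 1 / real p" using q Suc by simp
  from vabs_one_minus_power_p[OF this] show ?case
    using Suc by (simp add: power_mult mult.commute flip: power_mult)
qed simp

lemma vabs_qnum: "vabs (qnum q (p ^ n)) = 1 / real p ^ n"
  using q1 by (simp add: qnum_def vabs_divide vabs_one_minus_p_power)

lemma qnum_nonzero: "qnum q (p ^ n) \<noteq> 0"
proof
  assume "qnum q (p ^ n) = 0"
  then show False using vabs_qnum[of n] p_gt_1 by simp
qed

text \<open>
  The limit is \<open>(q - 1) / log q\<close>.  Consecutive terms differ by a factor
  \<open>(1 + Q + \<dots> + Q\<^sup>p\<^sup>-\<^sup>1) / p\<close> with \<open>Q = q ^ p ^ n\<close>, which tends to \<open>1\<close> because \<open>Q\<close> does.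
\<close>
lemma convergent_p_power_over_qnum: "convergent (\<lambda>n. of_nat p ^ n / qnum q (p ^ n))"
proof (rule convergent_if_diff_null)
  show "complete (UNIV :: 'a set)" using Cp by (simp add: is_Cp_def)
  let ?u = "\<lambda>n. of_nat p ^ n / qnum q (p ^ n)"
  have "vabs (?u (Suc n) - ?u n) \<le> real p * vabs (1 - q) / real p ^ n" for n
  proof -
    define Q where "Q = q ^ p ^ n"
    define s where "s = (\<Sum>j<p. Q ^ j)"
    have p0: "(of_nat p :: 'a) \<noteq> 0" using p_gt_1 by auto
    have "q ^ p ^ Suc n = Q ^ p" by (simp add: Q_def mult.commute flip: power_mult)
    then have s: "qnum q (p ^ Suc n) = qnum q (p ^ n) * s"
      by (simp add: qnum_def s_def one_diff_power_eq[of Q] Q_def[symmetric])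
    then have s0: "s \<noteq> 0" using qnum_nonzero[of "Suc n"] by auto
    have "?u n = ?u (Suc n) * (s / of_nat p)"
      unfolding s using s0 p0 by simp
    then have "?u (Suc n) - ?u n = ?u (Suc n) * (1 - s / of_nat p)"
      by (simp only: right_diff_distrib mult_1_right)
    also have "1 - s / of_nat p = (\<Sum>j<p. 1 - Q ^ j) / of_nat p"
      using p0 by (simp add: s_def sum_subtractf field_simps)
    finally have "vabs (?u (Suc n) - ?u n) = vabs (\<Sum>j<p. 1 - Q ^ j) * real p"
      using p_gt_1 by (simp add: vabs_mult vabs_divide vabs_qnum vabs_power vabs_p power_divide
          del: of_nat_power of_nat_mult power_Suc)
    also have "vabs (\<Sum>j<p. 1 - Q ^ j) \<le> vabs (1 - Q)"
    proof (rule vabs_sum_le)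
      have "vabs (1 - q) < 1"
        using q p_gt_1 one_le_power[of "vabs (1 - q)" "p - 1"]
        by (smt (verit) divide_le_eq_1_pos)
      then have "vabs q \<le> 1" using vabs_diff_ultra[of 1 "1 - q"] by simp
      then have "vabs Q \<le> 1" by (simp add: Q_def vabs_power power_le_one)
      then have "vabs (\<Sum>i<j. Q ^ i) \<le> 1" for j
        by (intro vabs_sum_le) (auto simp: vabs_power power_le_one)
      then show "vabs (1 - Q ^ j) \<le> vabs (1 - Q)" for j
        by (simp add: one_diff_power_eq vabs_mult mult_left_le)
    qed simp
    finally show ?thesis
      using p_gt_1 by (simp add: Q_def vabs_one_minus_p_power mult.commute)
  qed
  moreover have "(\<lambda>n. real p * vabs (1 - q) / real p ^ n) \<longlonglongrightarrow> 0"
    using p_gt_1 by (intro tendsto_divide_0[OF tendsto_const] filterlim_at_top_imp_at_infinity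
        filterlim_realpow_sequentially_gt1) auto
  ultimately show "(\<lambda>n. ?u (Suc n) - ?u n) \<longlonglongrightarrow> 0"
    by (intro tendsto_vabs_bound[where g = "\<lambda>n. real p * vabs (1 - q) / real p ^ n"])
      (simp_all only: diff_zero)
qed

section \<open>The associated distribution as a limit of Riemann sums\<close>

text \<open>
  The limit that defines the ball value exists: with \<open>m = k + n\<close>, the sequence is the product of
  \<open>p\<^sup>m / [p\<^sup>m]\<^sub>q\<close>, the constant \<open>p\<^sup>-\<^sup>n\<close>, and the Volkenborn mean values of
  \<open>x \<mapsto> f (a + p\<^sup>n x)\<close>.
\<close>
lemma assoc_ball_value_tendsto:
  assumes f: "C1_fun f"
  shows "(\<lambda>m. 1 / qnum q (p ^ m) * (\<Sum>x<p ^ (m - n). f (of_nat (a + p ^ n * x))))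
    \<longlonglongrightarrow> assoc_ball_value p q f n a"
proof -
  let ?X = "\<lambda>m. 1 / qnum q (p ^ m) * (\<Sum>x<p ^ (m - n). f (of_nat (a + p ^ n * x)))"
  have p0: "(of_nat p :: 'a) \<noteq> 0" using p_gt_1 by auto
  have "C1_fun (\<lambda>x. f (of_nat a + of_nat p ^ n * x))"
    using f p0 by (intro C1_fun_affine) (auto intro: Zp_of_nat Zp_of_nat_pow Zp_scale)
  from volkenborn_convergent[OF this]
  obtain V where V: "(\<lambda>k. (\<Sum>x<p ^ k. f (of_nat a + of_nat p ^ n * of_nat x)) / of_nat p ^ k) \<longlonglongrightarrow> V"
    by (auto simp: convergent_def)
  obtain u where u: "(\<lambda>m. of_nat p ^ m / qnum q (p ^ m)) \<longlonglongrightarrow> u"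
    using convergent_p_power_over_qnum by (auto simp: convergent_def)
  from tendsto_mult[OF tendsto_mult[OF LIMSEQ_ignore_initial_segment[OF u, of n] V]
      tendsto_const[of "1 / of_nat p ^ n"]]
  have "(\<lambda>k. ?X (k + n)) \<longlonglongrightarrow> u * V * (1 / of_nat p ^ n)"
    using p0 by (simp add: power_add divide_simps mult_ac)
  then have "?X \<longlonglongrightarrow> u * V * (1 / of_nat p ^ n)" by (rule LIMSEQ_offset)
  then show ?thesis unfolding assoc_ball_value_def by (simp add: limI)
qed

text \<open>
  By definition the value on \<open>U\<close> is a finite sum of limits over the balls of the level of \<open>U\<close>.
  Grouping the members of \<open>U\<close> below \<open>p\<^sup>m\<close> by these balls turns it into the limit of one Riemann
  sum over \<open>U\<close>, in which the level no longer occurs; this makes sets of different levels comparable.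
\<close>
lemma assoc_distribution_tendsto:
  assumes f: "C1_fun f" and U: "U \<in> compact_opens"
  shows "(\<lambda>m. 1 / qnum q (p ^ m) * (\<Sum>y | y < p ^ m \<and> of_nat y \<in> U. f (of_nat y)))
    \<longlonglongrightarrow> assoc_distribution p q f U"
proof -
  define n where "n = assoc_level p U"
  have level: "\<forall>x\<in>U. padic_ball p n x \<subseteq> U"
    using LeastI_ex[OF compact_open_level[OF U]] by (simp add: n_def assoc_level_def)
  define A where "A = {a. a < p ^ n \<and> padic_ball p n (of_nat a) \<subseteq> U}"
  have "(\<lambda>m. \<Sum>a\<in>A. 1 / qnum q (p ^ m) * (\<Sum>x<p ^ (m - n). f (of_nat (a + p ^ n * x))))
      \<longlonglongrightarrow> (\<Sum>a\<in>A. assoc_ball_value p q f n a)"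
    by (intro tendsto_sum assoc_ball_value_tendsto f)
  also have "(\<Sum>a\<in>A. assoc_ball_value p q f n a) = assoc_distribution p q f U"
    by (simp add: assoc_distribution_def A_def n_def Let_def)
  finally show ?thesis
  proof (rule Lim_transform_eventually)
    have "(\<Sum>a\<in>A. 1 / qnum q (p ^ m) * (\<Sum>x<p ^ (m - n). f (of_nat (a + p ^ n * x))))
      = 1 / qnum q (p ^ m) * (\<Sum>y | y < p ^ m \<and> of_nat y \<in> U. f (of_nat y))" if "m \<ge> n" for m
    proof -
      have "(\<Sum>y | y < p ^ m \<and> of_nat y \<in> U. f (of_nat y))
          = (\<Sum>y<p ^ m. if of_nat y \<in> U then f (of_nat y) else 0)"
        by (simp add: sum.If_cases Collect_conj_eq lessThan_def)
      also have "\<dots> = (\<Sum>y<p ^ n * p ^ (m - n). if of_nat y \<in> U then f (of_nat y) else 0)"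
        using that by (simp flip: power_add)
      also have "(\<Sum>y<p ^ n * p ^ (m - n). if of_nat y \<in> U then f (of_nat y) else 0)
          = (\<Sum>a<p ^ n. if padic_ball p n (of_nat a) \<subseteq> U
              then \<Sum>x<p ^ (m - n). f (of_nat (a + p ^ n * x)) else 0)"
        unfolding sum_residue_blocks mem_iff_ball_subset[OF level] by (intro sum.cong) auto
      also have "\<dots> = (\<Sum>a\<in>A. \<Sum>x<p ^ (m - n). f (of_nat (a + p ^ n * x)))"
        by (simp add: sum.If_cases A_def Collect_conj_eq lessThan_def)
      finally show ?thesis by (simp add: sum_distrib_left)
    qed
    then show "\<forall>\<^sub>F m in sequentially.
      (\<Sum>a\<in>A. 1 / qnum q (p ^ m) * (\<Sum>x<p ^ (m - n). f (of_nat (a + p ^ n * x))))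
      = 1 / qnum q (p ^ m) * (\<Sum>y | y < p ^ m \<and> of_nat y \<in> U. f (of_nat y))"
      by (rule eventually_sequentiallyI)
  qed
qed

end

end

section \<open>Splitting off the associated distribution\<close>

lemma power_less_of_less_powr:
  assumes p: "prime p" and v: "0 \<le> v" "v < real p powr (- (1 / (real p - 1)))"
  shows "v ^ (p - 1) < 1 / real p"
proof -
  have p2: "p \<ge> 2" using p prime_ge_2_nat by blast
  have "v ^ (p - 1) < (real p powr (- (1 / (real p - 1)))) ^ (p - 1)"
    using v p2 by (intro power_strict_mono) auto
  also have "\<dots> = real p powr (- (1 / (real p - 1)) * real (p - 1))"
    using p2 by (simp add: powr_realpow[symmetric] powr_powr del: minus_mult_left)
  also have "- (1 / (real p - 1)) * real (p - 1) = - 1"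
    using p2 by (simp add: of_nat_diff field_simps)
  also have "real p powr - 1 = 1 / real p"
    using p2 by (simp add: powr_minus divide_inverse)
  finally show ?thesis .
qed

theorem theorem4:
  fixes p :: nat and q :: "'a::nonarch_field" and \<mu> :: "'a set \<Rightarrow> 'a"
  assumes "prime p" and "is_Cp p TYPE('a)"
    and "q \<noteq> 1" and "vabs (1 - q) < real p powr (- (1 / (real p - 1)))"
    and "strongly_q_invariant p q \<mu>"
    and "C1_fun (RN_derivative p q \<mu>)"
  shows "\<exists>\<mu>\<^sub>2. is_padic_measure \<mu>\<^sub>2 \<and>
    (\<forall>U\<in>compact_opens. \<mu> U = assoc_distribution p q (RN_derivative p q \<mu>) U + \<mu>\<^sub>2 U)"
proof -
  note p = assms(1) and Cp = assms(2) and q1 = assms(3) and C1 = assms(6)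
  have q: "vabs (1 - q) ^ (p - 1) < 1 / real p"
    using power_less_of_less_powr[OF p _ assms(4)] by simp
  have \<mu>: "is_padic_distribution \<mu>" using assms(5) by (simp add: strongly_q_invariant_def)
  obtain c where c0: "c > 0" and c: "\<And>(a::int) n. n > 0 \<Longrightarrow>
      vabs (qnum q (p ^ n) * \<mu> (padic_ball p n (of_int a))
        - qnum q (p ^ Suc n) * \<mu> (padic_ball p (Suc n) (of_int a))) \<le> c / real p ^ n"
    using assms(5) unfolding strongly_q_invariant_def by blast
  let ?f = "RN_derivative p q \<mu>"
  let ?\<mu>\<^sub>1 = "assoc_distribution p q ?f"
  let ?S = "\<lambda>U m. 1 / qnum q (p ^ m) * (\<Sum>y | y < p ^ m \<and> of_nat y \<in> U. ?f (of_nat y))"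
  have lim: "?S U \<longlonglongrightarrow> ?\<mu>\<^sub>1 U" if "U \<in> compact_opens" for U
    by (rule assoc_distribution_tendsto[OF p Cp q1 q C1 that])

  have "?\<mu>\<^sub>1 (U \<union> V) = ?\<mu>\<^sub>1 U + ?\<mu>\<^sub>1 V"
    if U: "U \<in> compact_opens" and V: "V \<in> compact_opens" and "U \<inter> V = {}" for U V
  proof -
    have "?S (U \<union> V) m = ?S U m + ?S V m" for m
    proof -
      have "{y. y < p ^ m \<and> of_nat y \<in> U \<union> V} =
          {y. y < p ^ m \<and> of_nat y \<in> U} \<union> {y. y < p ^ m \<and> of_nat y \<in> V}" by auto
      then show ?thesis
        using \<open>U \<inter> V = {}\<close> by (auto simp: sum.union_disjoint distrib_left disjoint_iff)
    qed
    then have "?S (U \<union> V) \<longlonglongrightarrow> ?\<mu>\<^sub>1 U + ?\<mu>\<^sub>1 V"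
      using tendsto_add[OF lim[OF U] lim[OF V]] by simp
    then show ?thesis using lim[OF compact_opens_Un[OF U V]] LIMSEQ_unique by blast
  qed
  then have "is_padic_distribution (\<lambda>U. \<mu> U - ?\<mu>\<^sub>1 U)"
    using \<mu> unfolding is_padic_distribution_def by (simp add: algebra_simps)

  moreover have "vabs (\<mu> U - ?\<mu>\<^sub>1 U) \<le> c" if U: "U \<in> compact_opens" for U
  proof -
    obtain n where n: "\<forall>x\<in>U. padic_ball p n x \<subseteq> U" using compact_open_level[OF p Cp U] by blast
    (* the invariance estimate starts at level 1, while U may already be a union of balls of level 0 *)
    have "vabs (\<mu> U - ?S U m) \<le> c" if m: "m \<ge> max n 1" for m
    proof -
      let ?Q = "qnum q (p ^ m)"
      have Q0: "?Q \<noteq> 0" by (rule qnum_nonzero[OF p Cp q1 q])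
      have "\<mu> U - ?S U m = (\<Sum>y | y < p ^ m \<and> of_nat y \<in> U.
          - ((?f (of_nat y) - ?Q * \<mu> (padic_ball p m (of_nat y))) / ?Q))"
        using m Q0
        by (subst distribution_decompose[OF p Cp \<mu> U n, of m])
          (simp_all add: sum_distrib_left diff_divide_distrib flip: sum_subtractf)
      also have "vabs \<dots> \<le> c"
      proof (rule vabs_sum_le)
        fix y
        have "vabs (?f (of_nat y) - ?Q * \<mu> (padic_ball p m (of_nat y))) \<le> c / real p ^ m"
          using RN_derivative_approx[OF p Cp, where x = "of_nat y" and q = q and \<mu> = \<mu> and c = c and n = m]
            c[of _ "int y"] c0 m by simp
        then show "vabs (- ((?f (of_nat y) - ?Q * \<mu> (padic_ball p m (of_nat y))) / ?Q)) \<le> c"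
          using p_gt_1[OF p Cp] by (simp add: vabs_divide vabs_qnum[OF p Cp q1 q] field_simps)
      qed (use c0 in simp)
      finally show ?thesis .
    qed
    then have "\<forall>\<^sub>F m in sequentially. vabs (\<mu> U - ?S U m) \<le> c"
      by (rule eventually_sequentiallyI)
    then show ?thesis
      by (intro vabs_tendsto_le[OF tendsto_diff[OF tendsto_const lim[OF U]]])
  qed
  ultimately have "is_padic_measure (\<lambda>U. \<mu> U - ?\<mu>\<^sub>1 U)"
    unfolding is_padic_measure_def by blast
  then show ?thesis by (intro exI[of _ "\<lambda>U. \<mu> U - ?\<mu>\<^sub>1 U"]) simp
qed

end
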